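(* For all integers $n,k$ with $n\geq k\geq 2$, there are at least $k-1$ prime numbers $p$ with $n<p<kn$. *)

theory Defs
  imports Complex_Main "HOL-Computational_Algebra.Primes"
begin

end

theory Submission
  imports Defs "HOL-Library.Discrete_Functions"
begin

text \<open>
  The proof follows Erdos's argument for Bertrand's postulate. Let \<open>m = k n div 2\<close>,
  \<open>N = 2 m\<close> and \<open>s = floor_sqrt N\<close>. In the factorization of the central binomial
  coefficient, primes up to \<open>s\<close> contribute at most \<open>N\<close> each, the other prime
  divisors up to \<open>m\<close> are simple and at most \<open>N div 3\<close>, so that their product is at most
  \<open>4 ^ (N div 3)\<close>, and the \<open>P\<close>
  primes in \<open>(m, N]\<close> contribute at most \<open>N\<close> each. Since \<open>k\<^sup>2 \<le> k n \<le> N + 1\<close>,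
  \<open>P \<le> k - 2\<close> would give \<open>2 ^ N \<le> N ^ (6 * s)\<close> and hence \<open>2 ^ s \<le> (s + 1) ^ 12\<close>, which
  forces \<open>k n \<le> 5625\<close>. In this remaining range each interval \<open>(j n, (j + 1) n)\<close> with
  \<open>1 \<le> j < k\<close> contains a prime.
\<close>

section \<open>Legendre's formula and the prime powers in central binomial coefficients\<close>

text \<open>Passing from \<open>n\<close> to \<open>n + 1\<close> raises \<open>n div p ^ i\<close>
  by one exactly when \<open>p ^ i\<close> divides \<open>n + 1\<close>; summands with
  \<open>i \<ge> K\<close> would be 0.\<close>

lemma multiplicity_fact_nat:
  fixes p n :: nat
  assumes "prime p" "n < p ^ K"
  shows "multiplicity p (fact n) = (\<Sum>i=1..<K. n div p ^ i)"
  using assms(2)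
proof (induction n)
  case (Suc n)
  have dvd_iff: "p ^ i dvd Suc n \<longleftrightarrow> i \<le> multiplicity p (Suc n)" for i
    using assms(1) by (intro power_dvd_iff_le_multiplicity) (auto simp: prime_gt_1_nat)
  have "p ^ multiplicity p (Suc n) < p ^ K"
    using dvd_imp_le[OF multiplicity_dvd[of p "Suc n"]] Suc.prems by simp
  then have "multiplicity p (Suc n) < K"
    by (rule power_less_imp_less_exp[OF prime_gt_1_nat[OF assms(1)]])
  then have "{i \<in> {1..<K}. p ^ i dvd Suc n} = {1..multiplicity p (Suc n)}"
    by (auto simp only: dvd_iff atLeastLessThan_iff atLeastAtMost_iff)
  then have "multiplicity p (Suc n) = (\<Sum>i\<in>{i \<in> {1..<K}. p ^ i dvd Suc n}. 1)"
    by simp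
  also have "\<dots> = (\<Sum>i=1..<K. if p ^ i dvd Suc n then 1 else 0)"
    by (rule sum.inter_filter) simp
  finally have *: "multiplicity p (Suc n) = (\<Sum>i=1..<K. if p ^ i dvd Suc n then 1 else 0)" .
  have "multiplicity p (fact (Suc n)) = multiplicity p (Suc n) + multiplicity p (fact n)"
    using assms(1) by (simp add: prime_elem_multiplicity_mult_distrib del: mult_Suc)
  also have "\<dots> = (\<Sum>i=1..<K. (if p ^ i dvd Suc n then 1 else 0) + n div p ^ i)"
    using Suc by (simp only: * sum.distrib)
  also have "\<dots> = (\<Sum>i=1..<K. Suc n div p ^ i)"
    by (intro sum.cong) (auto simp: div_Suc dvd_eq_mod_eq_0)
  finally show ?case .
qed simp

lemma multiplicity_central_binomial:
  fixes p m :: nat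
  assumes "prime p" "2 * m < p ^ K"
  shows "multiplicity p ((2 * m) choose m) = (\<Sum>i=1..<K. (2 * m) div p ^ i - 2 * (m div p ^ i))"
proof -
  have "(fact (2 * m) :: nat) = fact m * fact m * ((2 * m) choose m)"
    using binomial_fact_lemma[of m "2 * m"] by (simp add: mult_2)
  then have "multiplicity p (fact (2 * m))
      = 2 * multiplicity p (fact m) + multiplicity p ((2 * m) choose m)"
    using assms(1) by (simp add: prime_elem_multiplicity_mult_distrib)
  moreover have "m < p ^ K" using assms(2) by simp
  ultimately have "multiplicity p ((2 * m) choose m)
      = (\<Sum>i=1..<K. (2 * m) div p ^ i) - (\<Sum>i=1..<K. 2 * (m div p ^ i))"
    using assms by (simp add: multiplicity_fact_nat sum_distrib_left)
  also have "\<dots> = (\<Sum>i=1..<K. (2 * m) div p ^ i - 2 * (m div p ^ i))"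
    by (intro sum_subtractf_nat[symmetric]) (simp add: less_eq_div_iff_mult_less_eq assms(1) prime_gt_0_nat)
  finally show ?thesis .
qed

lemma double_div_le: "(2 * m) div d - 2 * (m div d) \<le> (1::nat)"
proof (cases "d = 0")
  case False
  have "2 * m = d * (2 * (m div d)) + 2 * (m mod d)" 
    by (metis distrib_left_numeral mult.left_commute mult_div_mod_eq)
  moreover have "2 * (m mod d) < d * 2" using False by simp
  ultimately have "2 * m < d * (2 * (m div d) + 2)" by (simp add: algebra_simps)
  then have "(2 * m) div d < 2 * (m div d) + 2" using False
    by (simp add: less_mult_imp_div_less mult.commute)
  then show ?thesis by simp
qed simp

text \<open>Legendre's formula leaves \<open>K\<close> summands, each at most 1.\<close>

lemma multiplicity_central_binomial_le:
  fixes p m :: nat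
  assumes "prime p" "2 * m < p ^ Suc K"
  shows "multiplicity p ((2 * m) choose m) \<le> K"
proof -
  have "(\<Sum>i=1..<Suc K. (2 * m) div p ^ i - 2 * (m div p ^ i)) \<le> (\<Sum>i=1..<Suc K. 1)"
    by (intro sum_mono double_div_le)
  then show ?thesis by (simp only: multiplicity_central_binomial[OF assms]) simp
qed

lemma prime_power_central_binomial_le:
  fixes p m :: nat
  assumes "prime p" "0 < m"
  shows "p ^ multiplicity p ((2 * m) choose m) \<le> 2 * m"
proof -
  obtain K where K: "p ^ K \<le> 2 * m" "2 * m < p ^ Suc K"
    using ex_power_ivl1[of p "2 * m"] assms prime_ge_2_nat by auto
  then have "p ^ multiplicity p ((2 * m) choose m) \<le> p ^ K"
    using assms multiplicity_central_binomial_le prime_gt_0_nat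
    by (intro power_increasing) (auto simp: Suc_le_eq)
  with K show ?thesis by simp
qed

text \<open>Only the summand \<open>i = 1\<close> remains, and it is
  \<open>2 - 2 * 1\<close>.\<close>

lemma multiplicity_central_binomial_eq_0:
  fixes p m :: nat
  assumes "prime p" "2 * m < 3 * p" "p \<le> m" "2 * m < p\<^sup>2"
  shows "multiplicity p ((2 * m) choose m) = 0"
proof -
  have "(2 * m) div p = 2" "m div p = 1"
    using assms by (auto intro!: div_nat_eqI)
  then show ?thesis
    using multiplicity_central_binomial[OF assms(1,4)] by (simp add: numeral_2_eq_2)
qed

section \<open>Bounding products of primes by powers of 4\<close>

text \<open>The coefficient is one term of the lower half of row \<open>2 * m + 1\<close>, which
  sums to \<open>2 ^ (2 * m)\<close>.\<close>

lemma odd_binomial_le: "(2 * m + 1) choose m \<le> (4::nat) ^ m"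
  using member_le_sum[of m "{..m}" "\<lambda>k. (2 * m + 1) choose k"] binomial_r_part_sum[of m]
  by (simp add: power_mult)

lemma prod_primes_dvd_nat:
  fixes n :: nat
  assumes "finite A" "\<And>p. p \<in> A \<Longrightarrow> prime p" "\<And>p. p \<in> A \<Longrightarrow> p dvd n"
  shows "\<Prod>A dvd n"
  using assms
  by (induction A) (auto intro!: divides_mult prod_coprime_right primes_coprime)

text \<open>For odd \<open>n = 2 * m + 1\<close>, induction handles the primes up to
  \<open>m + 1\<close>; the remaining ones all divide \<open>(2 * m + 1) choose m\<close>, which is
  at most \<open>4 ^ m\<close>.\<close>

lemma primorial_le: "\<Prod>{p::nat. prime p \<and> p \<le> n} \<le> 4 ^ n"
proof (induction n rule: less_induct)
  case (less n)
  consider "n \<le> 2" | "2 < n" "even n" | m where "0 < m" "n = 2 * m + 1"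
    by (cases "n \<le> 2"; cases "even n") (auto elim!: oddE)
  then show ?case
  proof cases
    case 1
    have "p = 2 \<and> n = 2" if "prime p" "p \<le> n" for p :: nat
      using prime_ge_2_nat[OF that(1)] that(2) 1 by simp
    then have "{p::nat. prime p \<and> p \<le> n} = (if n = 2 then {2} else {})"
      by auto
    then show ?thesis by simp
  next
    case 2
    then have "\<not> prime n" using prime_odd_nat by auto
    then have "{p. prime p \<and> p \<le> n} = {p. prime p \<and> p \<le> n - 1}"
      by (auto simp: le_less)
    then have "\<Prod>{p. prime p \<and> p \<le> n} \<le> 4 ^ (n - 1)"
      using less.IH[of "n - 1"] 2 by simp
    also have "\<dots> \<le> 4 ^ n" by (intro power_increasing) auto
    finally show ?thesis .
  next
    case (3 m)
    define A where "A = {p. prime p \<and> p \<le> m + 1}"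
    define B where "B = {p. prime p \<and> m + 1 < p \<and> p \<le> 2 * m + 1}"
    have fin: "finite A" "finite B" by (auto simp: A_def B_def)
    have "p dvd (2 * m + 1) choose m" if "p \<in> B" for p
    proof -
      have p: "prime p" "m + 1 < p" "p \<le> 2 * m + 1" using that by (auto simp: B_def)
      have "fact m * fact (m + 1) * ((2 * m + 1) choose m) = (fact (2 * m + 1) :: nat)"
        using binomial_fact_lemma[of m "2 * m + 1"] by (simp add: mult_2 algebra_simps)
      moreover have "p dvd fact (2 * m + 1)" "\<not> p dvd fact m" "\<not> p dvd fact (m + 1)"
        using p by (simp_all only: prime_dvd_fact_iff)
      ultimately show ?thesis using p(1) by (metis prime_dvd_mult_iff)
    qed
    then have "\<Prod>B \<le> (2 * m + 1) choose m"
      using fin by (intro dvd_imp_le prod_primes_dvd_nat) (auto simp: B_def)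
    also have "\<dots> \<le> 4 ^ m" by (rule odd_binomial_le)
    finally have B: "\<Prod>B \<le> 4 ^ m" .
    have "\<Prod>A \<le> 4 ^ (m + 1)" unfolding A_def using 3 by (intro less.IH) auto
    from mult_le_mono[OF this B] have "\<Prod>A * \<Prod>B \<le> 4 ^ (m + 1) * 4 ^ m" .
    moreover have "{p. prime p \<and> p \<le> n} = A \<union> B" using 3 by (auto simp: A_def B_def)
    moreover have "A \<inter> B = {}" by (auto simp: A_def B_def)
    ultimately show ?thesis using 3 fin
      by (simp add: prod.union_disjoint power_add mult_2 mult.assoc)
  qed
qed

section \<open>Upper bound for the central binomial coefficient and the large range\<close>

lemma central_binomial_le_prod:
  fixes m :: nat
  assumes "0 < m"
  shows "(2 * m) choose m \<le> (2 * m) ^ floor_sqrt (2 * m) * 4 ^ ((2 * m) div 3)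
           * (2 * m) ^ card {p. prime p \<and> m < p \<and> p \<le> 2 * m}"
proof -
  define A where "A = {p. prime p \<and> p\<^sup>2 \<le> 2 * m}"
  define B where "B = {p. prime p \<and> p \<le> (2 * m) div 3}"
  define D where "D = {p. prime p \<and> m < p \<and> p \<le> 2 * m}"
  \<comment> \<open>The default 1 makes it enough that one of the three factors dominates the prime
    power, and lets the product over all \<open>p \<le> 2 * m\<close> split into three.\<close>
  define a where "a p = (if p \<in> A then 2 * m else 1)" for p
  define b where "b p = (if p \<in> B then p else 1)" for p
  define d where "d p = (if p \<in> D then 2 * m else 1)" for p
  define C where "C = (2 * m) choose m"
  have "C \<noteq> 0" by (simp add: C_def)
  have sub: "A \<subseteq> {..2 * m}" "B \<subseteq> {..2 * m}" "D \<subseteq> {..2 * m}"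
    by (auto simp: A_def B_def D_def power2_nat_le_imp_le)
  have pf: "prime_factors C \<subseteq> {..2 * m}"
  proof
    fix p assume "p \<in> prime_factors C"
    then have "prime p" "p dvd C" by auto
    moreover have "C dvd fact (2 * m)"
      unfolding C_def using binomial_fact_lemma[of m "2 * m"]
      by (metis dvd_triv_right mult_2 le_add1)
    ultimately show "p \<in> {..2 * m}" using prime_dvd_fact_iff dvd_trans by blast
  qed
  have le: "p ^ multiplicity p C \<le> a p * b p * d p" if "p \<in> prime_factors C" for p
  proof -
    have p: "prime p" "p dvd C" "p \<le> 2 * m" using that pf by auto
    have "1 \<le> a p" "1 \<le> b p" "1 \<le> d p"
      using assms p prime_ge_1_nat by (auto simp: a_def b_def d_def)
    then have ge: "a p \<le> a p * b p * d p" "b p \<le> a p * b p * d p" "d p \<le> a p * b p * d p"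
      by auto
    have le1: "p ^ multiplicity p C \<le> p" if "p \<notin> A"
    proof -
      have "multiplicity p C \<le> 1"
        unfolding C_def using that p
        by (intro multiplicity_central_binomial_le) (auto simp: A_def power2_eq_square)
      then show ?thesis using power_increasing[of _ 1 p] prime_ge_1_nat[OF p(1)] by simp
    qed
    have pos: "multiplicity p C \<noteq> 0"
      using p \<open>C \<noteq> 0\<close> by (auto simp: prime_multiplicity_gt_zero_iff)
    \<comment> \<open>A prime outside all three sets satisfies \<open>2 * m < 3 * p\<close>,
      \<open>p \<le> m\<close> and \<open>2 * m < p\<^sup>2\<close>, so its multiplicity would be
      0.\<close>
    consider "p \<in> A" | "p \<notin> A" "p \<in> B" | "p \<notin> A" "p \<in> D"
      using pos p multiplicity_central_binomial_eq_0[OF p(1), of m] unfolding C_def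
      by (fastforce simp: A_def B_def D_def)
    then show ?thesis
    proof cases
      case 1
      have "p ^ multiplicity p C \<le> a p"
        using prime_power_central_binomial_le[OF p(1) assms] 1 by (simp add: a_def C_def)
      then show ?thesis using ge(1) by (rule order_trans)
    next
      case 2
      with le1 have "p ^ multiplicity p C \<le> b p" by (simp add: b_def)
      then show ?thesis using ge(2) by (rule order_trans)
    next
      case 3
      with le1 p have "p ^ multiplicity p C \<le> d p" by (simp add: d_def)
      then show ?thesis using ge(3) by (rule order_trans)
    qed
  qed
  have "C = (\<Prod>p\<in>prime_factors C. p ^ multiplicity p C)"
    using \<open>C \<noteq> 0\<close> by (simp add: prime_factorization_nat)
  also have "\<dots> \<le> (\<Prod>p\<in>prime_factors C. a p * b p * d p)"
    using le by (intro prod_mono) auto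
  also have "\<dots> \<le> (\<Prod>p\<le>2 * m. a p * b p * d p)"
    using pf assms
    by (intro dvd_imp_le prod_dvd_prod_subset prod_pos)
      (auto simp: a_def b_def d_def B_def prime_gt_0_nat)
  also have "\<dots> = (2 * m) ^ card A * \<Prod>B * (2 * m) ^ card D"
    using sub by (simp add: prod.distrib a_def b_def d_def prod.If_cases Int_absorb1)
  also have "\<dots> \<le> (2 * m) ^ floor_sqrt (2 * m) * 4 ^ ((2 * m) div 3) * (2 * m) ^ card D"
  proof (intro mult_le_mono order_refl)
    have "A \<subseteq> {1..floor_sqrt (2 * m)}"
      by (auto simp: A_def le_floor_sqrt_iff Suc_le_eq prime_gt_0_nat)
    then have "card A \<le> floor_sqrt (2 * m)" using card_mono[of "{1..floor_sqrt (2 * m)}" A] by simp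
    then show "(2 * m) ^ card A \<le> (2 * m) ^ floor_sqrt (2 * m)"
      using assms by (intro power_increasing) auto
    show "\<Prod>B \<le> 4 ^ ((2 * m) div 3)" unfolding B_def by (rule primorial_le)
  qed
  finally show ?thesis unfolding C_def D_def .
qed

text \<open>The left side grows by at most the factor \<open>(77 / 76) ^ 12 < 2\<close> per step. At
  \<open>s = 74\<close> the inequality still fails.\<close>

lemma power_12_less_power_2: "75 \<le> s \<Longrightarrow> (s + 1) ^ 12 < (2::nat) ^ s"
proof (induction s rule: dec_induct)
  case (step s)
  have "(76 * (s + 2)) ^ 12 \<le> (77 * (s + 1)) ^ 12"
    using step.hyps by (intro power_mono) auto
  then have "76 ^ 12 * (s + 2) ^ 12 \<le> 77 ^ 12 * (s + 1) ^ 12"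
    by (simp only: power_mult_distrib)
  then have "(s + 2) ^ 12 \<le> 2 * (s + 1) ^ 12" by simp
  with step.IH show ?case by simp
qed simp

lemma card_primes_large:
  fixes m k :: nat
  assumes "5625 \<le> 2 * m" "k\<^sup>2 \<le> 2 * m + 1"
  shows "k \<le> card {p. prime p \<and> m < p \<and> p \<le> 2 * m} + 1"
proof (rule ccontr)
  define N where "N = 2 * m"
  define s where "s = floor_sqrt N"
  define P where "P = card {p. prime p \<and> m < p \<and> p \<le> 2 * m}"
  assume "\<not> k \<le> card {p. prime p \<and> m < p \<and> p \<le> 2 * m} + 1"
  then have "P + 2 \<le> k" by (simp add: P_def)
  have "s \<ge> 75" unfolding s_def le_floor_sqrt_iff using assms by (simp add: N_def)
  have N: "s\<^sup>2 \<le> N" "N < (s + 1)\<^sup>2"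
    unfolding s_def using Suc_floor_sqrt_power2_gt[of N] by auto
  have "m > 0" using assms by simp
  \<comment> \<open>\<open>N + 1 \<le> (s + 1)\<^sup>2\<close> bounds \<open>k\<close> by
    \<open>s + 1\<close>, so \<open>P < s\<close>; the exponents 1, \<open>s\<close> and
    \<open>P\<close> of \<open>N\<close> below then add up to at most \<open>2 * s\<close>.\<close>
  have "k < s + 2"
  proof (rule power2_less_imp_less)
    have "k\<^sup>2 \<le> (s + 1)\<^sup>2" using assms(2) N(2) unfolding N_def by linarith
    also have "\<dots> < (s + 2)\<^sup>2" by (simp add: power2_eq_square)
    finally show "k\<^sup>2 < (s + 2)\<^sup>2" .
  qed simp
  with \<open>P + 2 \<le> k\<close> have P: "1 + s + P \<le> 2 * s" by simp
  have "real (4 ^ m) \<le> real (N * (N choose m))"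
    using central_binomial_lower_bound[OF \<open>m > 0\<close>] \<open>m > 0\<close> by (simp add: N_def field_simps)
  then have "4 ^ m \<le> N * (N choose m)" by (simp only: of_nat_le_iff)
  then have "2 ^ N \<le> N * (N choose m)" by (simp add: N_def power_mult)
  also have "\<dots> \<le> N * (N ^ s * 4 ^ (N div 3) * N ^ P)"
    unfolding N_def s_def P_def by (intro mult_left_mono central_binomial_le_prod \<open>m > 0\<close>) simp
  also have "\<dots> = N ^ (1 + s + P) * 4 ^ (N div 3)"
    by (simp add: power_add)
  also have "\<dots> \<le> N ^ (2 * s) * 4 ^ (N div 3)"
    using P \<open>m > 0\<close> by (intro mult_right_mono power_increasing) (auto simp: N_def)
  \<comment> \<open>Cubing removes the division by 3: the power of 4 becomes at most
    \<open>2 ^ (2 * N)\<close>, which cancels.\<close>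
  finally have "(2 ^ N) ^ 3 \<le> (N ^ (2 * s) * 4 ^ (N div 3)) ^ 3"
    by (intro power_mono) auto
  also have "\<dots> = N ^ (6 * s) * 2 ^ (2 * (3 * (N div 3)))"
  proof -
    have "(4::nat) ^ x = 2 ^ (2 * x)" for x by (simp add: power_mult)
    then show ?thesis by (simp add: power_mult_distrib power_mult[symmetric] mult.commute)
  qed
  also have "\<dots> \<le> N ^ (6 * s) * 2 ^ (2 * N)"
    by (intro mult_left_mono power_increasing) auto
  finally have "2 ^ N * 2 ^ (2 * N) \<le> N ^ (6 * s) * 2 ^ (2 * N)"
    by (simp add: power_mult[symmetric] power_add[symmetric] mult.commute)
  then have "2 ^ N \<le> N ^ (6 * s)" by simp
  \<comment> \<open>Replacing \<open>N\<close> by \<open>s\<^sup>2\<close> on the left and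
    \<open>(s + 1)\<^sup>2\<close> on the right makes both sides \<open>s\<close>-th powers.\<close>
  have "(2 ^ s) ^ s \<le> (2::nat) ^ N"
    using N by (simp add: power_mult[symmetric] power2_eq_square)
  also have "\<dots> \<le> N ^ (6 * s)" by fact
  also have "\<dots> \<le> ((s + 1)\<^sup>2) ^ (6 * s)" using N by (intro power_mono) auto
  also have "\<dots> = ((s + 1) ^ 12) ^ s" by (simp add: power_mult[symmetric])
  finally have "2 ^ s \<le> (s + 1) ^ 12"
    using \<open>s \<ge> 75\<close> by (subst (asm) power_mono_iff) auto
  with power_12_less_power_2[OF \<open>s \<ge> 75\<close>] show False by simp
qed

section \<open>The finite range, covered by an explicit list of primes\<close>

text \<open>Trial division. Permitting \<open>q = p\<close> lets the test also accept primes below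
  \<open>b\<close>.\<close>

lemma prime_if_no_small_prime_divisor:
  fixes p b :: nat
  assumes "1 < p" "p < b\<^sup>2" "\<And>q. prime q \<Longrightarrow> q < b \<Longrightarrow> q dvd p \<Longrightarrow> q = p"
  shows "prime p"
proof (rule ccontr)
  assume "\<not> prime p"
  with \<open>1 < p\<close> obtain d where d: "d dvd p" "d \<noteq> 1" "d \<noteq> p"
    by (auto simp: prime_nat_iff)
  then obtain e where e: "p = d * e" by auto
  with \<open>1 < p\<close> d have "e dvd p" "e \<noteq> 1" "e \<noteq> p"
    by (cases "e = 0"; auto)+
  have "b \<le> c" if c: "c dvd p" "c \<noteq> 1" "c \<noteq> p" for c
  proof (rule ccontr)
    assume "\<not> b \<le> c"
    obtain q where q: "prime q" "q dvd c" using prime_factor_nat c(2) by blast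
    have "c < p" using c \<open>1 < p\<close> by (simp add: dvd_imp_le le_neq_implies_less)
    moreover have "0 < c" using c(1) \<open>1 < p\<close> by (auto intro: Nat.gr0I)
    then have "q \<le> c" using q(2) by (simp add: dvd_imp_le)
    ultimately show False
      using assms(3)[OF q(1)] q(2) c(1) \<open>\<not> b \<le> c\<close> by (auto dest: dvd_trans)
  qed
  from mult_le_mono[OF this[OF d] this[OF \<open>e dvd p\<close> \<open>e \<noteq> 1\<close> \<open>e \<noteq> p\<close>]] assms(2) e
  show False by (simp add: power2_eq_square)
qed

text \<open>A discrete intermediate value argument: a list that ends above \<open>x\<close> starts
  above it or crosses it between two neighbours.\<close>

lemma successively_crossing:
  fixes x :: "'a :: linorder"
  assumes "successively R xs" "xs \<noteq> []" "x < last xs"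
  shows "x < hd xs \<or> (\<exists>a b. R a b \<and> b \<in> set xs \<and> a \<le> x \<and> x < b)"
  using assms
proof (induction xs)
  case (Cons y xs)
  show ?case
  proof (cases "xs = []")
    case False
    with Cons have "R y (hd xs)"
      and "x < hd xs \<or> (\<exists>a b. R a b \<and> b \<in> set xs \<and> a \<le> x \<and> x < b)"
      by (auto simp: successively_Cons)
    then show ?thesis
      using hd_in_set[OF False] by (metis list.sel(1) list.set_intros(2) not_le)
  qed (use Cons.prems in simp)
qed simp

text \<open>
  A thinned-out list of primes, chosen greedily: consecutive entries differ by at most 34, and for
  \<open>2 \<le> n \<le> 34\<close> every interval \<open>(j n, (j + 1) n)\<close> with \<open>1 \<le> j < n\<close> contains an entry.
\<close>

definition sparse_primes :: "nat list" where
  "sparse_primes =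
     [3, 5, 7, 11, 13, 19, 23, 29, 31, 37, 47, 53, 61, 71, 79, 89, 97, 109, 113, 127, 139,
     151, 167, 181, 193, 199, 211, 233, 251, 269, 283, 293, 313, 331, 353, 373, 389, 409,
     433, 457, 479, 503, 523, 547, 571, 593, 619, 647, 673, 701, 727, 751, 773, 797, 829,
     863, 887, 919, 953, 983, 1013, 1019, 1051, 1069, 1087, 1117, 1151, 1153, 1187, 1217,
     1249, 1283, 1307, 1327, 1361, 1381, 1409, 1439, 1471, 1499, 1531, 1559, 1583, 1613,
     1637, 1669, 1699, 1733, 1759, 1789, 1823, 1847, 1879, 1913, 1933, 1951, 1979, 2011,
     2039, 2069, 2099, 2131, 2161, 2179, 2213, 2243, 2273, 2297, 2311, 2341, 2371, 2399,
     2423, 2447, 2477, 2503, 2531, 2557, 2591, 2621, 2647, 2677, 2711, 2741, 2767, 2801,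
     2833, 2861, 2887, 2917, 2939, 2971, 3001, 3023, 3049, 3083, 3109, 3137, 3169, 3203,
     3229, 3259, 3271, 3301, 3331, 3361, 3391, 3413, 3433, 3467, 3499, 3533, 3559, 3593,
     3623, 3643, 3677, 3709, 3739, 3769, 3803, 3833, 3863, 3889, 3923, 3947, 3967, 4001,
     4027, 4057, 4091, 4111, 4139, 4159, 4177, 4211, 4243, 4273, 4297, 4327, 4357, 4391,
     4423, 4457, 4483, 4517, 4549, 4583, 4603, 4637, 4663, 4691, 4723, 4751, 4783, 4817,
     4831, 4861, 4889, 4919, 4951, 4973, 5003, 5023, 5051, 5081, 5113, 5147, 5179, 5209,
     5237, 5261, 5281, 5309, 5333, 5351, 5381, 5413, 5443, 5477, 5507, 5531, 5563, 5591,
     5623, 5657]"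

lemma prime_sparse_primes:
  assumes "p \<in> set sparse_primes"
  shows "prime p"
proof -
  \<comment> \<open>These are the primes below 76, and \<open>76\<^sup>2 = 5776\<close> exceeds the
    last entry 5657.\<close>
  define qs :: "nat list" where
    "qs = [2, 3, 5, 7, 11, 13, 17, 19, 23, 29, 31, 37, 41, 43, 47, 53, 59, 61, 67, 71, 73]"
  have "list_all (\<lambda>p. 1 < p \<and> p < 76\<^sup>2 \<and> list_all (\<lambda>q. q dvd p \<longrightarrow> q = p) qs) sparse_primes"
    unfolding sparse_primes_def qs_def list.pred_inject by simp
  then have p: "1 < p" "p < 76\<^sup>2" "\<And>q. q \<in> set qs \<Longrightarrow> q dvd p \<Longrightarrow> q = p"
    using assms unfolding list_all_iff by blast+
  have "\<forall>q\<in>set [2..<76]. prime q \<longrightarrow> q \<in> set qs"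
    unfolding qs_def by simp
  then have "q \<in> set qs" if "prime q" "q < 76" for q
    using that prime_ge_2_nat[OF that(1)] by (metis atLeastLessThan_iff set_upt)
  with p show ?thesis
    by (intro prime_if_no_small_prime_divisor[of p 76]) blast+
qed

text \<open>
  The last disjunct says that no interval \<open>[j n, (j + 1) n]\<close> fits between \<open>a\<close> and \<open>b\<close>; the others
  are cheaper to check.
\<close>

lemma successively_sparse_primes:
  assumes "2 \<le> n"
  shows "successively (\<lambda>a b. b \<le> a + n \<or> n\<^sup>2 \<le> a \<or> b div n * n < a + n) sparse_primes"
proof (cases "n < 34")
  case True
  \<comment> \<open>On ground terms the simplifier evaluates \<open>if\<close> lazily, unlike \<open>\<or>\<close>.\<close>
  have "list_all (\<lambda>n. successively (\<lambda>a b. if b \<le> a + n then True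
      else if n\<^sup>2 \<le> a then True else b div n * n < a + n) sparse_primes)
    [2, 3, 4, 5, 6, 7, 8, 9, 10, 11, 12, 13, 14, 15, 16, 17, 18, 19, 20, 21, 22, 23, 24, 25, 26,
     27, 28, 29, 30, 31, 32, 33]"
    unfolding sparse_primes_def list.pred_inject successively.simps by simp
  moreover have "n \<in> set
    [2, 3, 4, 5, 6, 7, 8, 9, 10, 11, 12, 13, 14, 15, 16, 17, 18, 19, 20, 21, 22, 23, 24, 25, 26,
     27, 28, 29, 30, 31, 32, 33]"
    using assms True by simp arith
  ultimately show ?thesis
    by (simp only: list_all_iff if_bool_eq_disj) (auto elim: successively_mono)
next
  case False
  have "successively (\<lambda>a b. b \<le> a + 34) sparse_primes"
    by (simp add: sparse_primes_def)
  then show ?thesis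
    by (rule successively_mono) (use False in auto)
qed

lemma prime_between_multiples:
  fixes n j :: nat
  assumes "2 \<le> n" "1 \<le> j" "j < n" "j * n < 5657"
  shows "\<exists>p. prime p \<and> j * n < p \<and> p < (j + 1) * n"
proof -
  let ?R = "\<lambda>a b. b \<le> a + n \<or> n\<^sup>2 \<le> a \<or> b div n * n < a + n"
  have "j * n < n\<^sup>2" using assms by (simp add: power2_eq_square)
  have "2 * n \<le> (j + 1) * n" using assms by (intro mult_right_mono) auto
  have "sparse_primes \<noteq> []" "last sparse_primes = 5657" "hd sparse_primes = 3"
    by (simp_all add: sparse_primes_def)
  with successively_crossing[OF successively_sparse_primes[OF assms(1)], of "j * n"] assms(4)
  consider "j * n < 3" | a b where "?R a b" "b \<in> set sparse_primes" "a \<le> j * n" "j * n < b"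
    by auto
  then show ?thesis
  proof cases
    case 1
    then show ?thesis
      using assms(1) \<open>2 * n \<le> (j + 1) * n\<close> by (intro exI[of _ 3] conjI; (linarith | simp))
  next
    case (2 a b)
    have "prime b" using 2 by (intro prime_sparse_primes)
    \<comment> \<open>Both factors are at least 2, so the right endpoint is composite.\<close>
    moreover have "b \<noteq> (j + 1) * n"
      using \<open>prime b\<close> prime_product[of "j + 1" n] assms by auto
    moreover have "b \<le> (j + 1) * n"
      using 2(1)
    proof (elim disjE)
      \<comment> \<open>The largest multiple of \<open>n\<close> up to \<open>b\<close> lies below
        \<open>(j + 1) * n\<close>, hence so does \<open>b\<close>.\<close>
      assume "b div n * n < a + n"
      with 2 have "b div n * n < (j + 1) * n" by simp
      then have "b div n < j + 1" by (simp only: mult_less_cancel2)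
      with assms show ?thesis by (simp only: div_less_iff_less_mult)
    qed (use 2 \<open>j * n < n\<^sup>2\<close> in auto)
    ultimately have "prime b" "b < (j + 1) * n" by auto
    then show ?thesis using 2 by blast
  qed
qed

text \<open>The \<open>k - 1\<close> intervals are disjoint, so choosing one element from each is
  injective.\<close>

lemma card_ge_if_between_multiples:
  fixes n k :: nat
  assumes "\<And>j. 1 \<le> j \<Longrightarrow> j < k \<Longrightarrow> \<exists>p. P p \<and> j * n < p \<and> p < (j + 1) * n"
  shows "k - 1 \<le> card {p. P p \<and> n < p \<and> p < k * n}"
proof -
  obtain f where f: "P (f j)" "j * n < f j" "f j < (j + 1) * n" if "1 \<le> j" "j < k" for j
    using assms by metis
  have "inj_on f {1..<k}"
  proof (rule linorder_inj_onI)
    fix i j assume ij: "i < j" "i \<in> {1..<k}" "j \<in> {1..<k}"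
    have "f i < (i + 1) * n" using f ij by auto
    also have "\<dots> \<le> j * n" using ij by (intro mult_right_mono) auto
    also have "\<dots> < f j" using f ij by auto
    finally show "f i \<noteq> f j" by simp
  qed auto
  moreover have "f ` {1..<k} \<subseteq> {p. P p \<and> n < p \<and> p < k * n}"
  proof safe
    fix j assume j: "j \<in> {1..<k}"
    then show "P (f j)" using f by auto
    have "n = 1 * n" by simp
    also have "\<dots> \<le> j * n" using j by (intro mult_right_mono) auto
    also have "\<dots> < f j" using f j by auto
    finally show "n < f j" .
    have "f j < (j + 1) * n" using f j by auto
    also have "\<dots> \<le> k * n" using j by (intro mult_right_mono) auto
    finally show "f j < k * n" .
  qed
  ultimately have "card {1..<k} \<le> card {p. P p \<and> n < p \<and> p < k * n}"
    by (intro card_inj_on_le) auto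
  then show ?thesis by simp
qed

theorem theorem3p4p1:
  fixes n k :: nat
  assumes "n \<ge> k" and "k \<ge> 2"
  shows "card {p :: nat. prime p \<and> n < p \<and> p < k * n} \<ge> k - 1"
proof (cases "k * n \<le> 5625")
  case True
  show ?thesis
  proof (rule card_ge_if_between_multiples)
    fix j assume j: "1 \<le> j" "j < k"
    have "j * n \<le> k * n" using j by (intro mult_right_mono) auto
    with True have "j * n < 5657" by linarith
    with assms j show "\<exists>p. prime p \<and> j * n < p \<and> p < (j + 1) * n"
      by (intro prime_between_multiples) auto
  qed
next
  case False
  define m where "m = (k * n) div 2"
  have m: "2 * m \<le> k * n" "k * n \<le> 2 * m + 1" by (auto simp: m_def)
  have "k\<^sup>2 \<le> k * n" using assms by (simp add: power2_eq_square)
  with m False have "k - 1 \<le> card {p. prime p \<and> m < p \<and> p \<le> 2 * m}"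
    using card_primes_large[of m k] by linarith
  also have "\<dots> \<le> card {p. prime p \<and> n < p \<and> p < k * n}"
  proof (intro card_mono subsetI)
    fix p assume "p \<in> {p. prime p \<and> m < p \<and> p \<le> 2 * m}"
    then have p: "prime p" "m < p" "p \<le> 2 * m" by auto
    \<comment> \<open>From \<open>k \<ge> 2\<close> follows \<open>n \<le> m\<close>, so primes
      above \<open>m\<close> exceed \<open>n\<close>; the upper bound is strict because
      \<open>k * n\<close> is composite.\<close>
    have "2 * n \<le> k * n" using assms by (intro mult_right_mono) auto
    with m(2) have "n \<le> m" by linarith
    moreover have "p \<noteq> k * n" using p(1) prime_product[of k n] assms by auto
    ultimately show "p \<in> {p. prime p \<and> n < p \<and> p < k * n}"
      using p m(1) by auto
  qed simp
  finally show ?thesis .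
qed

end
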